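(* Let $(\mathfrak{g},\mathfrak{n})$ be a pair of finite-dimensional complex Lie algebras on the same underlying vector space, where $\mathfrak{g}$ is perfect and $\mathfrak{n}$ is reductive with a $1$-dimensional center. Then there is no PA-structure on $(\mathfrak{g},\mathfrak{n})$.
   Context: A Lie algebra $\mathfrak{g}$ is perfect if $\mathfrak{g}=[\mathfrak{g},\mathfrak{g}]$. Let $\mathfrak{g}=(V,[\,,])$ and $\mathfrak{n}=(V,\{\,,\})$ be two Lie algebra structures on the same vector space $V$ over $\mathbb{C}$. A post-Lie algebra structure (PA-structure) on the pair $(\mathfrak{g},\mathfrak{n})$ is a $\mathbb{C}$-bilinear product $(x,y)\mapsto x\cdot y$ on $V$ satisfying, for all $x,y,z\in V$: (1) $x\cdot y-y\cdot x=[x,y]-\{x,y\}$; (2) $[x,y]\cdot z=x\cdot(y\cdot z)-y\cdot(x\cdot z)$; (3) $x\cdot\{y,z\}=\{x\cdot y,z\}+\{y,x\cdot z\}$. *)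

theory Defs
  imports Complex_Main
begin

locale bilinear_product = vector_space scale
  for scale :: "'k::field \<Rightarrow> 'v::ab_group_add \<Rightarrow> 'v" +
  fixes mul :: "'v \<Rightarrow> 'v \<Rightarrow> 'v"
  assumes linear_left: "Vector_Spaces.linear scale scale (\<lambda>x. mul x y)"
    and linear_right: "Vector_Spaces.linear scale scale (\<lambda>y. mul x y)"

text \<open>The underlying vector space of a Lie algebra is the whole type \<open>'v\<close>, so that two Lie
  algebra structures on the same vector space share the parameter \<open>scale\<close> and differ only in
  the bracket.\<close>

locale lie_algebra = bilinear_product scale bracket
  for scale :: "'k::field \<Rightarrow> 'v::ab_group_add \<Rightarrow> 'v" and bracket :: "'v \<Rightarrow> 'v \<Rightarrow> 'v" +
  assumes alternating: "bracket x x = 0"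
    and jacobi: "bracket x (bracket y z) + bracket y (bracket z x) + bracket z (bracket x y) = 0"
begin

definition derived_algebra :: "'v set" where
  "derived_algebra = span {bracket x y | x y. True}"

definition perfect :: bool where
  "perfect \<longleftrightarrow> derived_algebra = UNIV"

definition center :: "'v set" where
  "center = {z. \<forall>x. bracket z x = 0}"

definition lie_ideal :: "'v set \<Rightarrow> bool" where
  "lie_ideal I \<longleftrightarrow> subspace I \<and> (\<forall>x. \<forall>y\<in>I. bracket x y \<in> I)"

text \<open>Reductive means that the adjoint representation is completely reducible (Bourbaki's
  definition). The invariant subspaces of the adjoint representation are the ideals, so this
  says that every ideal has a complementary ideal.\<close>

definition reductive :: bool where
  "reductive \<longleftrightarrow> (\<forall>I. lie_ideal I \<longrightarrow>
     (\<exists>J. lie_ideal J \<and> I \<inter> J = {0} \<and> {a + b | a b. a \<in> I \<and> b \<in> J} = UNIV))"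

end

text \<open>\<open>g\<close> and \<open>n\<close> are the brackets \<open>[x, y]\<close> and \<open>{x, y}\<close> of the two Lie algebras of the pair.\<close>

locale post_lie_structure =
  g: lie_algebra scale g + n: lie_algebra scale n + bilinear_product scale mul
  for scale :: "'k::field \<Rightarrow> 'v::ab_group_add \<Rightarrow> 'v"
    and g :: "'v \<Rightarrow> 'v \<Rightarrow> 'v" and n :: "'v \<Rightarrow> 'v \<Rightarrow> 'v" and mul :: "'v \<Rightarrow> 'v \<Rightarrow> 'v" +
  assumes commutator: "mul x y - mul y x = g x y - n x y"
    and left_module: "mul (g x y) z = mul x (mul y z) - mul y (mul x z)"
    and derivation: "mul x (n y z) = n (mul x y) z + n y (mul x z)"

end

theory Submission
  imports Defs
begin

text \<open>Every left multiplication \<open>D = mul x\<close> is a derivation of \<open>n\<close>, so it preserves both the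
  derived algebra \<open>[n, n]\<close> and the center \<open>Z\<close> of \<open>n\<close>. Since \<open>Z\<close> is a line, \<open>g\<close> acts on it by
  scalars; scalars commute, so brackets of \<open>g\<close> act on \<open>Z\<close> by zero, and as \<open>g\<close> is perfect all of \<open>g\<close>
  does. Reductivity gives \<open>V = [n, n] + Z\<close>, hence \<open>D\<close> maps all of \<open>V\<close> into \<open>[n, n]\<close>.

  Now \<open>g x y = n x y + mul x y - mul y x\<close> has all three terms in \<open>[n, n]\<close>, so perfectness of \<open>g\<close>
  gives \<open>V = [n, n]\<close>. But reductivity also splits \<open>Z\<close> off from an ideal containing \<open>[n, n]\<close>, so \<open>n\<close>
  can only be perfect when \<open>Z = 0\<close>, contradicting that \<open>Z\<close> is a line.\<close>

context bilinear_product
begin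

lemma mul_bilinear_simps:
  "mul (a + b) y = mul a y + mul b y" "mul x (a + b) = mul x a + mul x b"
  "mul (scale c a) y = scale c (mul a y)" "mul x (scale c a) = scale c (mul x a)"
  "mul 0 y = 0" "mul x 0 = 0"
proof -
  interpret l: Vector_Spaces.linear scale scale "\<lambda>x. mul x y" by (rule linear_left)
  interpret r: Vector_Spaces.linear scale scale "\<lambda>y. mul x y" by (rule linear_right)
  show "mul (a + b) y = mul a y + mul b y" "mul x (a + b) = mul x a + mul x b"
    "mul (scale c a) y = scale c (mul a y)" "mul x (scale c a) = scale c (mul x a)"
    "mul 0 y = 0" "mul x 0 = 0"
    by (simp_all add: l.add r.add l.scale r.scale l.zero r.zero)
qed

lemma subspace_left_preimage:
  assumes "subspace S"
  shows "subspace {x. mul x y \<in> S}"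
  using assms by (simp add: subspace_def mul_bilinear_simps)

lemma subspace_right_preimage:
  assumes "subspace S"
  shows "subspace {y. mul x y \<in> S}"
  using assms by (simp add: subspace_def mul_bilinear_simps)

end

context vector_space
begin

lemma line_spanned_by_vector:
  assumes "dim S = 1"
  obtains z where "z \<in> S" "z \<noteq> 0" "\<And>w. w \<in> S \<Longrightarrow> \<exists>c. w = scale c z"
proof -
  obtain B where B: "B \<subseteq> S" "independent B" "S \<subseteq> span B" "card B = dim S"
    using basis_exists by blast
  then obtain z where z: "B = {z}"
    using assms by (auto simp: card_1_singleton_iff)
  show thesis
  proof
    show "z \<in> S" "z \<noteq> 0" using B z by auto
    show "\<exists>c. w = scale c z" if "w \<in> S" for w
      using that B(3) unfolding z span_singleton by auto
  qed
qed

end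

context lie_algebra
begin

lemma antisymmetric: "bracket x y = - bracket y x"
proof -
  have "0 = bracket (x + y) (x + y)"
    by (simp only: alternating)
  also have "\<dots> = bracket x y + bracket y x"
    by (simp only: mul_bilinear_simps) (simp add: alternating)
  finally show ?thesis
    by (metis eq_neg_iff_add_eq_0)
qed

lemma bracket_in_derived: "bracket x y \<in> derived_algebra"
  unfolding derived_algebra_def by (rule span_base) blast

lemma subspace_derived: "subspace derived_algebra"
  unfolding derived_algebra_def by (rule subspace_span)

lemma derived_subset:
  assumes "subspace S" and "\<And>x y. bracket x y \<in> S"
  shows "derived_algebra \<subseteq> S"
  unfolding derived_algebra_def using assms by (intro span_minimal) auto

lemma bracket_center: "z \<in> center \<Longrightarrow> bracket z x = 0" "z \<in> center \<Longrightarrow> bracket x z = 0"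
  by (simp_all add: center_def antisymmetric[of x z])

lemma lie_ideal_center: "lie_ideal center"
  unfolding lie_ideal_def
proof (intro conjI allI ballI)
  show "subspace center"
    by (auto simp: subspace_def center_def mul_bilinear_simps)
  show "bracket x z \<in> center" if "z \<in> center" for x z
    using that by (simp add: bracket_center) (simp add: center_def mul_bilinear_simps)
qed

lemma lie_ideal_derived: "lie_ideal derived_algebra"
  unfolding lie_ideal_def by (simp add: subspace_derived bracket_in_derived)

lemma reductive_complement:
  assumes reductive and "lie_ideal I"
  shows "\<exists>J. lie_ideal J \<and> I \<inter> J = {0} \<and> (\<forall>v. \<exists>a b. v = a + b \<and> a \<in> I \<and> b \<in> J)"
  using assms(1)[unfolded reductive_def, rule_format, OF assms(2)]
  by (simp only: set_eq_iff[of "Collect _" UNIV] mem_Collect_eq UNIV_I simp_thms)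

text \<open>An ideal complementary to the derived algebra is central, because its brackets lie both in
  itself and in the derived algebra.\<close>

lemma reductive_decomposition:
  assumes reductive
  obtains d z where "v = d + z" "d \<in> derived_algebra" "z \<in> center"
proof -
  obtain J where J: "lie_ideal J" "derived_algebra \<inter> J = {0}"
    and sum: "\<forall>v. \<exists>a b. v = a + b \<and> a \<in> derived_algebra \<and> b \<in> J"
    using reductive_complement[OF assms lie_ideal_derived] by (elim exE conjE)
  have "J \<subseteq> center"
  proof
    fix b assume "b \<in> J"
    then have "bracket x b \<in> derived_algebra \<inter> J" for x
      using J(1) by (simp add: lie_ideal_def bracket_in_derived)
    then have "bracket x b = 0" for x
      using J(2) by blast
    then have "bracket b x = 0" for x
      by (subst antisymmetric) simp
    then show "b \<in> center"
      by (simp add: center_def)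
  qed
  moreover obtain a b where "v = a + b" "a \<in> derived_algebra" "b \<in> J"
    using sum[rule_format, of v] by (elim exE conjE)
  ultimately show thesis
    using that by blast
qed

text \<open>If \<open>J\<close> is an ideal complementary to the center, only the \<open>J\<close>-components contribute to a
  bracket, so the derived algebra lies in \<open>J\<close>; for a perfect algebra this makes \<open>J\<close> everything.\<close>

lemma reductive_perfect_center_trivial:
  assumes reductive and perfect
  shows "center = {0}"
proof -
  obtain J where J: "lie_ideal J" "center \<inter> J = {0}"
    and sum: "\<forall>v. \<exists>a b. v = a + b \<and> a \<in> center \<and> b \<in> J"
    using reductive_complement[OF assms(1) lie_ideal_center] by (elim exE conjE)
  have "bracket x y \<in> J" for x y
  proof -
    obtain a b where "y = a + b" "a \<in> center" "b \<in> J"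
      using sum[rule_format, of y] by (elim exE conjE)
    then show ?thesis
      using J(1) by (simp add: mul_bilinear_simps bracket_center lie_ideal_def)
  qed
  then have "derived_algebra \<subseteq> J"
    using J(1) by (intro derived_subset) (auto simp: lie_ideal_def)
  then show ?thesis
    using J(2) assms(2) by (auto simp: perfect_def)
qed

end

context post_lie_structure
begin

lemma mul_derived_in_derived:
  assumes "d \<in> n.derived_algebra"
  shows "mul x d \<in> n.derived_algebra"
proof -
  have "n.derived_algebra \<subseteq> {d. mul x d \<in> n.derived_algebra}"
  proof (rule n.derived_subset)
    show "g.subspace {d. mul x d \<in> n.derived_algebra}"
      by (rule subspace_right_preimage) (rule n.subspace_derived)
    show "n y z \<in> {d. mul x d \<in> n.derived_algebra}" for y z
      using g.subspace_add[OF n.subspace_derived n.bracket_in_derived n.bracket_in_derived]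
      by (simp add: derivation)
  qed
  then show ?thesis using assms by blast
qed

lemma mul_center_in_center:
  assumes "z \<in> n.center"
  shows "mul x z \<in> n.center"
proof -
  have "n (mul x z) y = 0" for y
    using derivation[of x z y] by (simp add: n.bracket_center[OF assms] mul_bilinear_simps)
  then show ?thesis by (simp add: n.center_def)
qed

text \<open>The left multiplications represent \<open>g\<close> on the center of \<open>n\<close>, and a one-dimensional
  representation factors through the abelianization of \<open>g\<close>, which is zero for perfect \<open>g\<close>.\<close>

lemma perfect_acts_trivially_on_line_center:
  assumes "g.perfect" and "g.dim n.center = 1" and "w \<in> n.center"
  shows "mul x w = 0"
proof -
  obtain z where z: "z \<in> n.center" and line: "\<And>w. w \<in> n.center \<Longrightarrow> \<exists>c. w = scale c z"
    using g.line_spanned_by_vector[OF assms(2)] by metis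
  have "g.derived_algebra \<subseteq> {x. mul x z \<in> {0}}"
  proof (rule g.derived_subset)
    show "g.subspace {x. mul x z \<in> {0}}"
      by (rule subspace_left_preimage) (rule g.subspace_single_0)
    fix x y
    obtain a b where "mul x z = scale a z" "mul y z = scale b z"
      using line mul_center_in_center z by meson
    then show "g x y \<in> {x. mul x z \<in> {0}}"
      by (simp add: left_module mul_bilinear_simps mult.commute)
  qed
  then have "mul x z = 0"
    using assms(1) by (auto simp: g.perfect_def)
  then show ?thesis
    using line[OF assms(3)] by (auto simp: mul_bilinear_simps)
qed

text \<open>A derivation of a reductive algebra that kills the center has its image in the derived
  algebra. When this applies to all left multiplications, the two brackets agree modulo the derived
  algebra of \<open>n\<close>, which therefore contains the derived algebra of \<open>g\<close>.\<close>

lemma perfect_inherited_if_center_killed: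
  assumes "g.perfect" and "n.reductive" and kill: "\<And>x w. w \<in> n.center \<Longrightarrow> mul x w = 0"
  shows "n.perfect"
proof -
  have mul: "mul x y \<in> n.derived_algebra" for x y
  proof -
    obtain d z where "y = d + z" "d \<in> n.derived_algebra" "z \<in> n.center"
      using n.reductive_decomposition[OF assms(2)] by blast
    then show ?thesis
      by (simp add: mul_bilinear_simps kill mul_derived_in_derived)
  qed
  have "g x y = n x y + (mul x y - mul y x)" for x y
    using commutator[of x y] by (simp add: algebra_simps)
  then have "g x y \<in> n.derived_algebra" for x y
    using mul n.bracket_in_derived n.subspace_derived
    by (metis g.subspace_add g.subspace_diff)
  then have "g.derived_algebra \<subseteq> n.derived_algebra"
    by (intro g.derived_subset n.subspace_derived)
  then show ?thesis
    using assms(1) by (auto simp: g.perfect_def n.perfect_def)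
qed

end

theorem proposition3p14:
  fixes scale :: "complex \<Rightarrow> 'v::ab_group_add \<Rightarrow> 'v"
    and Basis :: "'v set"
    and g n :: "'v \<Rightarrow> 'v \<Rightarrow> 'v"
  assumes "finite_dimensional_vector_space scale Basis"
    and "lie_algebra scale g"
    and "lie_algebra scale n"
    and "lie_algebra.perfect scale g"
    and "lie_algebra.reductive scale n"
    and "vector_space.dim scale (lie_algebra.center n) = 1"
  shows "\<not> (\<exists>mul. post_lie_structure scale g n mul)"
proof
  assume "\<exists>mul. post_lie_structure scale g n mul"
  then obtain mul where "post_lie_structure scale g n mul" ..
  then interpret post_lie_structure scale g n mul .
  have "n.perfect"
    using perfect_inherited_if_center_killed perfect_acts_trivially_on_line_center assms(4-6)
    by blast
  then have "n.center = {0}"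
    using n.reductive_perfect_center_trivial assms(5) by blast
  moreover obtain z where "z \<in> n.center" "z \<noteq> 0"
    using g.line_spanned_by_vector[OF assms(6)] by metis
  ultimately show False by blast
qed

end
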